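(* Let $Y$ be a finite set, $\mathbb{M}$ a complete MV-chain, $f:\mathbb{M}^Y\to\mathbb{M}^Y$ a non-expansive function and $H_{\max}$ a max-decomposition of $f$. Consider the following procedure: (1) choose any strategy $C_0$ in $H_{\max}$ and set $i:=0$; (2a) compute $\mu f_{C_i}$; (2b) if the set $\mathit{imp}^s_{\max}(C_i)$ of stable max-improvements of $C_i$ is nonempty, choose any $C_{i+1}\in\mathit{imp}^s_{\max}(C_i)$, set $i:=i+1$ and go to (2a); (2c) else stop. Then every run of this procedure terminates, and when it stops, $\mu f_{C_i}=\mu f$.
   Context: An MV-algebra is a tuple $(\mathbb{M},\oplus,0,\overline{(\cdot)})$ where $(\mathbb{M},\oplus,0)$ is a commutative monoid and $\overline{(\cdot)}:\mathbb{M}\to\mathbb{M}$ satisfies, for all $x,y$: $\overline{\overline{x}}=x$, $x\oplus\overline{0}=\overline{0}$, and $\overline{(\overline{x}\oplus y)}\oplus y=\overline{(\overline{y}\oplus x)}\oplus x$. Write $x\ominus y=\overline{\overline{x}\oplus y}$. The natural order is $x\sqsubseteq y$ iff $x\oplus z=y$ for some $z\in\mathbb{M}$. An MV-chain is an MV-algebra whose natural order is total; it is complete if it is a complete lattice under the natural order. For a set $Y$, $\mathbb{M}^Y$ carries the pointwise order and pointwise $\ominus$; $a\sqsubset b$ means $a\sqsubseteq b$ and $a\neq b$. For finite $Y$ and $a\in\mathbb{M}^Y$, $\|a\|=\max_{y\in Y}a(y)$. A function $g:\mathbb{M}^Y\to\mathbb{M}^Z$ is non-expansive if $\|g(b)\ominus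 g(a)\|\sqsubseteq\|b\ominus a\|$ for all $a,b\in\mathbb{M}^Y$. For a monotone endofunction $g$ on a complete lattice, $\mu g$ is its least fixpoint. A max-decomposition of $f:\mathbb{M}^Y\to\mathbb{M}^Y$ is a map $H_{\max}$ assigning to each $y\in Y$ a finite set $H_{\max}(y)$ of monotone functions $\mathbb{M}^Y\to\mathbb{M}$ such that $f(a)(y)=\max_{h\in H_{\max}(y)}h(a)$ for all $a\in\mathbb{M}^Y$, $y\in Y$. A strategy in $H_{\max}$ is a function $C$ on $Y$ with $C(y)\in H_{\max}(y)$ for all $y$; it induces the monotone map $f_C:\mathbb{M}^Y\to\mathbb{M}^Y$, $f_C(a)(y)=C(y)(a)$. Given strategies $C,C'$ in $H_{\max}$, $C'$ is a max-improvement of $C$ if $\mu f_C\sqsubset f_{C'}(\mu f_C)$; it is a stable max-improvement if moreover $C'(y)=C(y)$ for every $y\in Y$ with $f_{C'}(\mu f_C)(y)=\mu f_C(y)$. $\mathit{imp}^s_{\max}(C)$ denotes the set of stable max-improvements of $C$.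
   Formalization: The formal theorem additionally assumes that f_C is non-expansive for every strategy C in H_max (equivalently, every function in each H_max(y) is non-expansive); with merely monotone components the procedure can cycle. *)

theory Defs
  imports Main
begin

class mv_algebra = comm_monoid_add +
  fixes mv_neg :: "'a \<Rightarrow> 'a"
  assumes mv_neg_neg: "mv_neg (mv_neg x) = x"
    and mv_add_top: "x + mv_neg 0 = mv_neg 0"
    and mv_lukasiewicz: "mv_neg (mv_neg x + y) + y = mv_neg (mv_neg y + x) + x"

definition mv_diff :: "'m::mv_algebra \<Rightarrow> 'm \<Rightarrow> 'm" (infixl "\<ominus>" 65) where
  "x \<ominus> y = mv_neg (mv_neg x + y)"

text \<open>The class \<open>canonically_ordered_monoid_add\<close> contributes the axiom
  \<open>a \<le> b \<longleftrightarrow> (\<exists>c. b = a + c)\<close>, so \<open>\<le>\<close> is the natural order of the MV-algebra;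
  \<open>complete_linorder\<close> says that this order is total and is a complete lattice.
  For a type \<open>'y\<close> the function type \<open>'y \<Rightarrow> 'm\<close> then carries the pointwise order as a
  complete lattice, \<open><\<close> on it is \<open>\<le>\<close> together with \<open>\<noteq>\<close>, and \<open>lfp\<close> is the least fixpoint of
  a monotone endofunction.\<close>

class complete_mv_chain = mv_algebra + canonically_ordered_monoid_add + complete_linorder

definition mv_norm :: "('y::finite \<Rightarrow> 'm::complete_mv_chain) \<Rightarrow> 'm" where
  "mv_norm a = Max (range a)"

definition nonexpansive ::
  "(('y::finite \<Rightarrow> 'm::complete_mv_chain) \<Rightarrow> ('z::finite \<Rightarrow> 'm)) \<Rightarrow> bool" where
  "nonexpansive g \<longleftrightarrow>
     (\<forall>a b. mv_norm (\<lambda>z. g b z \<ominus> g a z) \<le> mv_norm (\<lambda>y. b y \<ominus> a y))"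

text \<open>Nonemptiness of \<open>H y\<close> is what makes the maximum over \<open>H y\<close> meaningful.\<close>

definition max_decomposition ::
  "(('y::finite \<Rightarrow> 'm::complete_mv_chain) \<Rightarrow> ('y \<Rightarrow> 'm)) \<Rightarrow> ('y \<Rightarrow> (('y \<Rightarrow> 'm) \<Rightarrow> 'm) set) \<Rightarrow> bool"
where
  "max_decomposition f H \<longleftrightarrow>
     (\<forall>y. finite (H y) \<and> H y \<noteq> {} \<and> (\<forall>h\<in>H y. mono h)) \<and>
     (\<forall>a y. f a y = Max ((\<lambda>h. h a) ` H y))"

definition strategy ::
  "('y \<Rightarrow> (('y \<Rightarrow> 'm) \<Rightarrow> 'm) set) \<Rightarrow> ('y \<Rightarrow> (('y \<Rightarrow> 'm) \<Rightarrow> 'm)) \<Rightarrow> bool" where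
  "strategy H C \<longleftrightarrow> (\<forall>y. C y \<in> H y)"

definition induced_map ::
  "('y \<Rightarrow> (('y \<Rightarrow> 'm) \<Rightarrow> 'm)) \<Rightarrow> ('y \<Rightarrow> 'm) \<Rightarrow> ('y \<Rightarrow> 'm)" where
  "induced_map C a = (\<lambda>y. C y a)"

definition max_improvement ::
  "('y::finite \<Rightarrow> (('y \<Rightarrow> 'm::complete_mv_chain) \<Rightarrow> 'm) set) \<Rightarrow>
   ('y \<Rightarrow> (('y \<Rightarrow> 'm) \<Rightarrow> 'm)) \<Rightarrow> ('y \<Rightarrow> (('y \<Rightarrow> 'm) \<Rightarrow> 'm)) \<Rightarrow> bool" where
  "max_improvement H C C' \<longleftrightarrow> strategy H C \<and> strategy H C' \<and>
     lfp (induced_map C) < induced_map C' (lfp (induced_map C))"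

definition stable_max_improvements ::
  "('y::finite \<Rightarrow> (('y \<Rightarrow> 'm::complete_mv_chain) \<Rightarrow> 'm) set) \<Rightarrow>
   ('y \<Rightarrow> (('y \<Rightarrow> 'm) \<Rightarrow> 'm)) \<Rightarrow> ('y \<Rightarrow> (('y \<Rightarrow> 'm) \<Rightarrow> 'm)) set" where
  "stable_max_improvements H C = {C'. max_improvement H C C' \<and>
     (\<forall>y. induced_map C' (lfp (induced_map C)) y = lfp (induced_map C) y \<longrightarrow> C' y = C y)}"

text \<open>\<open>iteration_upto H C n\<close>: the strategies \<open>C 0, \<dots>, C n\<close> are the first ones chosen in
  some execution of strategy iteration; entries beyond \<open>n\<close> are irrelevant. An execution
  stops at \<open>C n\<close> iff \<open>C n\<close> has no stable max-improvement, so a nonterminating execution is a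
  sequence \<open>C\<close> with \<open>iteration_upto H C n\<close> for every \<open>n\<close>.\<close>

definition iteration_upto ::
  "('y::finite \<Rightarrow> (('y \<Rightarrow> 'm::complete_mv_chain) \<Rightarrow> 'm) set) \<Rightarrow>
   (nat \<Rightarrow> ('y \<Rightarrow> (('y \<Rightarrow> 'm) \<Rightarrow> 'm))) \<Rightarrow> nat \<Rightarrow> bool" where
  "iteration_upto H C n \<longleftrightarrow>
     strategy H (C 0) \<and> (\<forall>i<n. C (Suc i) \<in> stable_max_improvements H (C i))"

text \<open>The decomposition of a non-expansive map is understood to be into non-expansive pieces,
  so that \<open>induced_map C\<close> is non-expansive for every strategy \<open>C\<close>; this does not follow from
  \<open>max_decomposition\<close> and has to be assumed separately. Without it strategy iteration can
  cycle: on the chain \<open>0 < 1 < 2\<close> with truncated addition and a one-element index set, the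
  non-expansive map \<open>f a = a + 1\<close> is the maximum of the monotone functions \<open>h\<^sub>1 a = 1\<close> and
  \<open>h\<^sub>2 a = (if a = 0 then 0 else 2)\<close>. Their least fixpoints are \<open>1\<close> and \<open>0\<close>, and since
  \<open>h\<^sub>2 1 = 2\<close> and \<open>h\<^sub>1 0 = 1\<close>, each is a stable max-improvement of the other.\<close>

end

(* The least fixpoint strictly increases along the iteration, and there are only finitely many
   strategies. For the increase let a be the least fixpoint of f_C, let g = f_C' and let b be
   the least fixpoint of g. Suppose that d, the maximum of a - b, is positive. Since a lies below
   g a, non-expansiveness forces g a = a wherever a - b attains d, so by stability f_C and g
   agree there. If d' < d bounds the other values of a - b, then min(a, b + d') is a
   pre-fixpoint of f_C, hence a lies below b + d', contradicting the choice of d.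
   At a strategy without stable improvement, a is a fixpoint of f: otherwise, switching
   to a maximizing component exactly where f a exceeds a would be a stable improvement. *)

theory Submission
  imports Defs
begin

text \<open>At the top element \<open>mv_neg 0\<close> the Lukasiewicz axiom has top on the left, by
  absorption, and \<open>mv_neg x + x\<close> on the right.\<close>

lemma mv_neg_add_self:
  fixes x :: "'m::mv_algebra"
  shows "mv_neg x + x = mv_neg 0"
  using mv_lukasiewicz[of x "mv_neg 0"] mv_add_top[of "mv_neg x"]
    mv_add_top[of "mv_neg (mv_neg x + mv_neg 0)"]
  by (simp add: mv_neg_neg)

text \<open>Turns the order into an equation, so that order facts follow by rewriting. From right to
  left, the Lukasiewicz axiom provides the witness \<open>y \<ominus> x\<close>.\<close>

lemma le_iff_mv_neg_add:
  fixes x y :: "'m::complete_mv_chain"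
  shows "x \<le> y \<longleftrightarrow> mv_neg x + y = mv_neg 0"
proof
  assume "x \<le> y"
  then obtain c where "y = x + c"
    by (auto simp: le_iff_add)
  then have "mv_neg x + y = c + (mv_neg x + x)"
    by (simp add: ac_simps)
  then show "mv_neg x + y = mv_neg 0"
    by (simp add: mv_neg_add_self mv_add_top)
next
  assume "mv_neg x + y = mv_neg 0"
  then have "y = x + mv_neg (mv_neg y + x)"
    using mv_lukasiewicz[of x y] by (simp add: mv_neg_neg add.commute)
  then show "x \<le> y"
    by (auto simp: le_iff_add)
qed

text \<open>Residuation: as equations, both sides read
  \<open>mv_neg x + y + z = mv_neg 0\<close>.\<close>

lemma mv_diff_le_iff:
  fixes x y z :: "'m::complete_mv_chain"
  shows "x \<ominus> y \<le> z \<longleftrightarrow> x \<le> y + z"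
  by (simp add: le_iff_mv_neg_add mv_diff_def mv_neg_neg add.assoc)

lemma mv_diff_add_cancel:
  fixes x y :: "'m::complete_mv_chain"
  assumes "y \<le> x"
  shows "y + (x \<ominus> y) = x"
  using assms mv_lukasiewicz[of x y]
  by (simp add: le_iff_mv_neg_add mv_diff_def mv_neg_neg add.commute)

lemma mv_norm_le_iff:
  fixes a :: "'y::finite \<Rightarrow> 'm::complete_mv_chain"
  shows "mv_norm a \<le> d \<longleftrightarrow> (\<forall>y. a y \<le> d)"
  unfolding mv_norm_def by (subst Max_le_iff) auto

text \<open>Residuation removes norm and difference from non-expansiveness; only this form is
  applied below.\<close>

lemma nonexpansive_le_add:
  fixes a b :: "'y::finite \<Rightarrow> 'm::complete_mv_chain"
  assumes "nonexpansive g" and "\<And>y. a y \<le> b y + d"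
  shows "g a z \<le> g b z + d"
proof -
  have "mv_norm (\<lambda>y. a y \<ominus> b y) \<le> d"
    using assms(2) by (simp add: mv_norm_le_iff mv_diff_le_iff)
  with assms(1) have "mv_norm (\<lambda>z. g a z \<ominus> g b z) \<le> d"
    unfolding nonexpansive_def using order_trans by blast
  then show ?thesis
    by (simp add: mv_norm_le_iff mv_diff_le_iff)
qed

text \<open>Here \<open>f\<close> and \<open>g\<close> stand for the maps of the old and the new
  strategy, and \<open>agree\<close> expresses stability.\<close>

lemma lfp_le_lfp_nonexpansive:
  fixes f g :: "('y::finite \<Rightarrow> 'm::complete_mv_chain) \<Rightarrow> ('y \<Rightarrow> 'm)"
  assumes "mono f" "mono g" "nonexpansive g"
    and post: "lfp f \<le> g (lfp f)"
    and agree: "\<And>y x. g (lfp f) y = lfp f y \<Longrightarrow> g x y = f x y"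
  shows "lfp f \<le> lfp g"
proof (rule ccontr)
  define a where "a = lfp f"
  define b where "b = lfp g"
  define d where "d = mv_norm (\<lambda>y. a y \<ominus> b y)"
  \<comment> \<open>The largest difference below \<open>d\<close>, or \<open>0\<close> if there is
    none; the inserted \<open>0\<close> is harmless once \<open>d\<close> is known to be
    positive.\<close>
  define d' where "d' = Max (insert 0 {a y \<ominus> b y |y. a y \<ominus> b y < d})"
  have fa: "f a = a" and gb: "g b = b"
    unfolding a_def b_def using assms(1,2) by (simp_all add: lfp_fixpoint)
  assume "\<not> lfp f \<le> lfp g"
  then obtain y0 where "\<not> a y0 \<le> b y0"
    unfolding a_def b_def le_fun_def by blast
  then have "\<not> a y0 \<ominus> b y0 \<le> 0"
    using mv_diff_le_iff[of "a y0" "b y0" 0] by simp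
  moreover have le_d: "a y \<ominus> b y \<le> d" for y
    using mv_norm_le_iff[of "\<lambda>y. a y \<ominus> b y" d] unfolding d_def by blast
  ultimately have d_pos: "0 < d"
    by (metis order_less_le_trans not_le)
  have fin: "finite {a y \<ominus> b y |y. a y \<ominus> b y < d}"
    by simp
  have d'_less: "d' < d"
    unfolding d'_def using fin d_pos by (subst Max_less_iff) auto
  have le_d': "a y \<le> b y + d'" if "a y \<ominus> b y \<noteq> d" for y
  proof -
    have "a y \<ominus> b y < d"
      using that le_d[of y] by simp
    then have "a y \<ominus> b y \<le> d'"
      unfolding d'_def using fin by (intro Max_ge) auto
    then show ?thesis
      by (simp add: mv_diff_le_iff)
  qed
  \<comment> \<open>Comparing \<open>a\<close> with the fixpoint \<open>b\<close> bounds
    \<open>g a y\<close> by \<open>b y + d\<close>, which is \<open>a y\<close> at such a point;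
    \<open>post\<close> is the converse bound.\<close>
  have ga: "g a y = a y" if "a y \<ominus> b y = d" for y
  proof -
    have "\<not> a y \<le> b y"
      using that d_pos by (metis mv_diff_le_iff add_0_right not_le)
    moreover have "a y \<le> g a y"
      using post unfolding a_def le_fun_def by blast
    moreover have "g a y \<le> b y + d"
      using nonexpansive_le_add[OF assms(3), of a b d y] le_d gb by (simp add: mv_diff_le_iff)
    ultimately show ?thesis
      using that mv_diff_add_cancel[of "b y" "a y"] by simp
  qed
  \<comment> \<open>The cut at \<open>b + d'\<close> changes \<open>a\<close> only where the
    difference is \<open>d\<close>. There \<open>f\<close> may be replaced by \<open>g\<close>,
    which keeps \<open>a'\<close> below \<open>b + d'\<close> because it fixes
    \<open>b\<close>.\<close>
  define a' where "a' = (\<lambda>y. min (a y) (b y + d'))"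
  have "f a' y \<le> a' y" for y
  proof -
    have "a' \<le> a"
      unfolding a'_def le_fun_def by simp
    then have fa': "f a' y \<le> a y"
      using monoD[OF assms(1)] fa by (metis le_fun_def)
    moreover have "f a' y \<le> b y + d'"
    proof (cases "a y \<ominus> b y = d")
      case True
      then have "g a' y = f a' y"
        using ga agree unfolding a_def by blast
      moreover have "g a' y \<le> b y + d'"
        using nonexpansive_le_add[OF assms(3), of a' b d' y] gb unfolding a'_def by simp
      ultimately show ?thesis
        by simp
    next
      case False
      then show ?thesis
        using fa' le_d' order_trans by blast
    qed
    ultimately show ?thesis
      unfolding a'_def by simp
  qed
  then have "a \<le> a'"
    unfolding a_def by (intro lfp_lowerbound) (simp add: le_fun_def)
  then have "a y \<ominus> b y \<le> d'" for y
    unfolding a'_def le_fun_def by (simp add: mv_diff_le_iff)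
  then have "d \<le> d'"
    unfolding d_def by (simp add: mv_norm_le_iff)
  with d'_less show False
    by simp
qed

lemma finite_strategies:
  fixes H :: "'y::finite \<Rightarrow> (('y \<Rightarrow> 'm) \<Rightarrow> 'm) set"
  assumes "\<And>y. finite (H y)"
  shows "finite {C. strategy H C}"
proof -
  have "{C. strategy H C} \<subseteq> {C. \<forall>y. C y \<in> (\<Union>y. H y)}"
    unfolding strategy_def by blast
  \<comment> \<open>With the whole finite index type as domain, the default value
    \<open>undefined\<close> is never taken.\<close>
  moreover have "finite {C. \<forall>y::'y. (y \<in> UNIV \<longrightarrow> C y \<in> (\<Union>y. H y)) \<and> (y \<notin> UNIV \<longrightarrow> C y = undefined)}"
    using assms by (intro finite_set_of_finite_funs) auto
  ultimately show ?thesis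
    by (simp add: finite_subset)
qed

lemma mono_induced_map:
  assumes "max_decomposition f H" "strategy H C"
  shows "mono (induced_map C)"
proof (rule monoI)
  fix a b :: "'a \<Rightarrow> 'b"
  assume "a \<le> b"
  moreover have "mono (C y)" for y
    using assms unfolding max_decomposition_def strategy_def by blast
  ultimately show "induced_map C a \<le> induced_map C b"
    unfolding induced_map_def le_fun_def[of "\<lambda>y. C y a"] by (blast dest: monoD)
qed

lemma induced_map_le:
  assumes "max_decomposition f H" "strategy H C"
  shows "induced_map C a \<le> f a"
  using assms unfolding max_decomposition_def strategy_def induced_map_def le_fun_def
  by simp

lemma lfp_less_stable_max_improvement:
  assumes "max_decomposition f H"
    and "\<And>C. strategy H C \<Longrightarrow> nonexpansive (induced_map C)"
    and imp: "C' \<in> stable_max_improvements H C"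
  shows "lfp (induced_map C) < lfp (induced_map C')"
proof -
  have strat: "strategy H C" "strategy H C'"
    and less: "lfp (induced_map C) < induced_map C' (lfp (induced_map C))"
    and stable: "\<And>y. induced_map C' (lfp (induced_map C)) y = lfp (induced_map C) y
                   \<Longrightarrow> C' y = C y"
    using imp unfolding stable_max_improvements_def max_improvement_def by blast+
  have mono: "mono (induced_map C)" "mono (induced_map C')"
    using mono_induced_map[OF assms(1)] strat by auto
  have "lfp (induced_map C) \<le> lfp (induced_map C')"
  proof (rule lfp_le_lfp_nonexpansive[OF mono assms(2)[OF strat(2)] less_imp_le[OF less]])
    fix y x
    assume "induced_map C' (lfp (induced_map C)) y = lfp (induced_map C) y"
    then have "C' y = C y"
      by (rule stable)
    then show "induced_map C' x y = induced_map C x y"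
      unfolding induced_map_def by (rule fun_cong)
  qed
  \<comment> \<open>If both were equal, the old least fixpoint would be fixed by the new map, which
    strictly increases it.\<close>
  moreover have "lfp (induced_map C) \<noteq> lfp (induced_map C')"
    using less lfp_fixpoint[OF mono(2)] by (metis less_irrefl)
  ultimately show ?thesis
    by simp
qed

lemma lfp_eq_if_no_stable_max_improvement:
  assumes dec: "max_decomposition f H" and strat: "strategy H C"
    and none: "stable_max_improvements H C = {}"
  shows "lfp (induced_map C) = lfp f"
proof -
  define a where "a = lfp (induced_map C)"
  have fix_a: "induced_map C a = a"
    unfolding a_def using lfp_fixpoint[OF mono_induced_map[OF dec strat]] .
  have a_le: "a \<le> f a"
    using induced_map_le[OF dec strat, of a] fix_a by simp
  have "\<exists>h\<in>H y. h a = f a y" for y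
  proof -
    have "Max ((\<lambda>h. h a) ` H y) \<in> (\<lambda>h. h a) ` H y"
      using dec unfolding max_decomposition_def by (intro Max_in) auto
    then show ?thesis
      using dec unfolding max_decomposition_def by (auto simp: image_iff)
  qed
  then obtain B where B: "\<And>y. B y \<in> H y" "\<And>y. B y a = f a y"
    by metis
  \<comment> \<open>Keeping \<open>C\<close> wherever \<open>f a\<close> and \<open>a\<close> agree
    is what makes the switch stable.\<close>
  define C' where "C' = (\<lambda>y. if f a y = a y then C y else B y)"
  have C'_a: "induced_map C' a = f a"
    using B(2) fix_a unfolding C'_def induced_map_def fun_eq_iff by auto
  have "strategy H C'"
    using strat B(1) unfolding C'_def strategy_def by simp
  moreover have "C' y = C y" if "f a y = a y" for y
    using that by (simp add: C'_def)
  ultimately have "C' \<in> stable_max_improvements H C" if "a < f a"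
    using that strat C'_a
    unfolding stable_max_improvements_def max_improvement_def a_def[symmetric] by simp
  with none have "\<not> a < f a"
    by blast
  with a_le have "f a = a"
    by (simp add: less_le)
  then have "lfp f \<le> a"
    by (intro lfp_lowerbound) simp
  \<comment> \<open>Every strategy's map lies pointwise below \<open>f\<close>, so its least
    fixpoint lies below that of \<open>f\<close>.\<close>
  moreover have "a \<le> lfp f"
    unfolding a_def by (intro lfp_mono induced_map_le[OF dec strat])
  ultimately show ?thesis
    unfolding a_def by simp
qed

lemma iteration_upto_strategy:
  assumes "iteration_upto H C n"
  shows "strategy H (C n)"
proof (cases n)
  case 0
  with assms show ?thesis
    unfolding iteration_upto_def by simp
next
  case (Suc m)
  with assms have "C n \<in> stable_max_improvements H (C m)"
    unfolding iteration_upto_def by simp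
  then show ?thesis
    unfolding stable_max_improvements_def max_improvement_def by blast
qed

theorem mainTheorem2:
  fixes f :: "('y::finite \<Rightarrow> 'm::complete_mv_chain) \<Rightarrow> ('y \<Rightarrow> 'm)"
    and H :: "'y \<Rightarrow> (('y \<Rightarrow> 'm) \<Rightarrow> 'm) set"
  assumes "nonexpansive f"
    and "max_decomposition f H"
    and "\<And>C. strategy H C \<Longrightarrow> nonexpansive (induced_map C)"
  shows "(\<nexists>C. \<forall>n. iteration_upto H C n) \<and>
         (\<forall>C n. iteration_upto H C n \<and> stable_max_improvements H (C n) = {} \<longrightarrow>
                lfp (induced_map (C n)) = lfp f)"
proof (intro conjI allI impI notI)
  assume "\<exists>C. \<forall>n. iteration_upto H C n"
  then obtain C where C: "\<And>n. iteration_upto H C n"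
    by blast
  have "C (Suc n) \<in> stable_max_improvements H (C n)" for n
    using C[of "Suc n"] unfolding iteration_upto_def by simp
  then have "lfp (induced_map (C n)) < lfp (induced_map (C (Suc n)))" for n
    using lfp_less_stable_max_improvement[OF assms(2,3)] by blast
  \<comment> \<open>Strictly increasing least fixpoints make all strategies of an infinite run
    distinct, against their finite number.\<close>
  then have "strict_mono (\<lambda>n. lfp (induced_map (C n)))"
    by (simp add: strict_mono_Suc_iff)
  then have "inj (\<lambda>n. lfp (induced_map (C n)))"
    by (rule strict_mono_imp_inj_on)
  then have "inj C"
    by (auto simp: inj_on_def)
  moreover have "finite (range C)"
  proof (rule finite_subset)
    show "range C \<subseteq> {C. strategy H C}"
      using C iteration_upto_strategy by blast
    show "finite {C. strategy H C}"
      using assms(2) unfolding max_decomposition_def by (intro finite_strategies) blast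
  qed
  ultimately show False
    using finite_imageD by blast
next
  fix C n
  assume "iteration_upto H C n \<and> stable_max_improvements H (C n) = {}"
  then show "lfp (induced_map (C n)) = lfp f"
    using lfp_eq_if_no_stable_max_improvement[OF assms(2)] iteration_upto_strategy by blast
qed

end
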